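(* Let $\mathcal U$ be a bialgebra over $\mathbb C$ with counit $\varepsilon$ and comultiplication $\Delta$, and let $\mathcal C$ be a unital associative algebra over $\mathbb C$ which is a left $\mathcal U$-module with action $\xi:\mathcal U\otimes\mathcal C\to\mathcal C$, $x\otimes f\mapsto \xi_x\cdot f$, satisfying $$\xi_x\cdot 1=\varepsilon(x)\,1\quad\text{and}\quad \xi_x\cdot(fg)=(\xi_{x_{(1)}}\cdot f)(\xi_{x_{(2)}}\cdot g)\qquad\forall x\in\mathcal U,\ \forall f,g\in\mathcal C.$$ (i) Suppose that a linear mapping $\varphi:\mathcal U\to\mathcal C$ satisfies $$\varphi(1)=1,\qquad \varphi(xy)=\bigl(\xi_{x_{(1)}}\cdot\varphi(y)\bigr)\,\varphi(x_{(2)})\quad\forall x,y\in\mathcal U. \qquad(\ast)$$ Then the prescription $$x\cdot f:=(\xi_{x_{(1)}}\cdot f)\,\varphi(x_{(2)}),\qquad x\in\mathcal U,\ f\in\mathcal C, \qquad(\ast\ast)$$ defines a left $\mathcal U$-module structure on $\mathcal C$, and it holds that $$x\cdot(fg)=(\xi_{x_{(1)}}\cdot f)(x_{(2)}\cdot g)\qquad\forall x\in\mathcal U,\ \forall f,g\in\mathcal C. \qquad(\ast\!\ast\!\ast)$$ In particular, $\varphi(x)=x\cdot 1$ for all $x\in\mathcal U$. (ii) Conversely, suppose that $\mathcal U\otimes\mathcal C\to\mathcal C:\ x\otimes f\mapsto x\cdot f$ is a left $\mathcal U$-module structure on $\mathcal C$ such that the rule $(\ast\!\ast\!\ast)$ is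 satisfied. Then the linear mapping $\varphi:\mathcal U\to\mathcal C$ defined by $\varphi(x):=x\cdot 1$ fulfills both conditions in $(\ast)$, and consequently the prescription $(\ast\ast)$ holds true for all $x\in\mathcal U$, $f\in\mathcal C$.
   Context: Sweedler's notation is used: $\Delta x=x_{(1)}\otimes x_{(2)}$ (summation understood). The bialgebra $\mathcal U$ is not required to have an antipode. Module structures are unital ($\xi_1\cdot f=f$ and $1\cdot f=f$) and tensor products are over $\mathbb C$. *)

theory Defs
  imports Complex_Main "HOL-Library.Poly_Mapping"
begin

section \<open>Complex vector spaces and algebras\<close>

class complex_vector = ab_group_add +
  fixes scaleC :: "complex \<Rightarrow> 'a \<Rightarrow> 'a" (infixr \<open>*\<^sub>C\<close> 75)
  assumes scaleC_add_right: "a *\<^sub>C (x + y) = a *\<^sub>C x + a *\<^sub>C y"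
    and scaleC_add_left: "(a + b) *\<^sub>C x = a *\<^sub>C x + b *\<^sub>C x"
    and scaleC_scaleC: "a *\<^sub>C (b *\<^sub>C x) = (a * b) *\<^sub>C x"
    and scaleC_one: "1 *\<^sub>C x = x"

global_interpretation cvec: vector_space "scaleC :: complex \<Rightarrow> 'a \<Rightarrow> 'a::complex_vector"
  by unfold_locales (simp_all add: scaleC_add_right scaleC_add_left scaleC_scaleC scaleC_one)

text \<open>Unital associative algebras. Using \<^class>\<open>monoid_mult\<close> with \<^class>\<open>ring\<close> instead of
  \<^class>\<open>ring_1\<close> admits the zero algebra.\<close>

class complex_algebra_1 = complex_vector + ring + monoid_mult +
  assumes mult_scaleC_left: "(a *\<^sub>C x) * y = a *\<^sub>C (x * y)"
    and mult_scaleC_right: "x * (a *\<^sub>C y) = a *\<^sub>C (x * y)"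

instantiation complex :: complex_algebra_1
begin
definition scaleC_complex :: "complex \<Rightarrow> complex \<Rightarrow> complex" where
  "scaleC_complex = (*)"
instance by standard (simp_all add: scaleC_complex_def algebra_simps)
end

abbreviation clinear :: "('a::complex_vector \<Rightarrow> 'b::complex_vector) \<Rightarrow> bool" where
  "clinear \<equiv> Vector_Spaces.linear scaleC scaleC"

definition cbilinear :: "('a::complex_vector \<Rightarrow> 'b::complex_vector \<Rightarrow> 'c::complex_vector) \<Rightarrow> bool" where
  "cbilinear B \<longleftrightarrow> (\<forall>a. clinear (B a)) \<and> (\<forall>b. clinear (\<lambda>a. B a b))"

lemma clinear_iff:
  "clinear f \<longleftrightarrow> (\<forall>x y. f (x + y) = f x + f y) \<and> (\<forall>c x. f (c *\<^sub>C x) = c *\<^sub>C f x)"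
  by (simp add: Vector_Spaces.linear_iff cvec.vector_space_axioms)

lemma cbilinear_iff:
  "cbilinear B \<longleftrightarrow>
     (\<forall>a a' b. B (a + a') b = B a b + B a' b) \<and> (\<forall>a b b'. B a (b + b') = B a b + B a b') \<and>
     (\<forall>c a b. B (c *\<^sub>C a) b = c *\<^sub>C B a b) \<and> (\<forall>c a b. B a (c *\<^sub>C b) = c *\<^sub>C B a b)"
  unfolding cbilinear_def clinear_iff by blast


section \<open>Tensor products\<close>

instantiation poly_mapping :: (type, complex_vector) complex_vector
begin
lift_definition scaleC_poly_mapping :: "complex \<Rightarrow> ('a \<Rightarrow>\<^sub>0 'b) \<Rightarrow> ('a \<Rightarrow>\<^sub>0 'b)"
  is "\<lambda>c f k. c *\<^sub>C f k"
  by (erule finite_subset[rotated]) auto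
instance
  by standard
    (auto intro!: poly_mapping_eqI simp: scaleC_poly_mapping.rep_eq lookup_add cvec.scale_right_distrib cvec.scale_left_distrib)
end

text \<open>The free vector space on pairs modulo the subspace spanned by the bilinearity relations.\<close>

definition tensor_relators :: "('a::complex_vector \<times> 'b::complex_vector \<Rightarrow>\<^sub>0 complex) set" where
  "tensor_relators =
     {Poly_Mapping.single (a + a', b) 1 - Poly_Mapping.single (a, b) 1 - Poly_Mapping.single (a', b) 1 |a a' b. True} \<union>
     {Poly_Mapping.single (a, b + b') 1 - Poly_Mapping.single (a, b) 1 - Poly_Mapping.single (a, b') 1 |a b b'. True} \<union>
     {Poly_Mapping.single (c *\<^sub>C a, b) 1 - c *\<^sub>C Poly_Mapping.single (a, b) 1 |a b c. True} \<union>
     {Poly_Mapping.single (a, c *\<^sub>C b) 1 - c *\<^sub>C Poly_Mapping.single (a, b) 1 |a b c. True}"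

definition tensor_rel ::
  "('a::complex_vector \<times> 'b::complex_vector \<Rightarrow>\<^sub>0 complex) \<Rightarrow> ('a \<times> 'b \<Rightarrow>\<^sub>0 complex) \<Rightarrow> bool" where
  "tensor_rel p q \<longleftrightarrow> p - q \<in> cvec.span tensor_relators"

lemma equivp_tensor_rel:
  "equivp (tensor_rel :: ('a::complex_vector \<times> 'b::complex_vector \<Rightarrow>\<^sub>0 complex) \<Rightarrow> _)"
  (is "equivp ?R")
proof (rule equivpI)
  show "reflp ?R"
    by (auto simp: reflp_def tensor_rel_def cvec.span_zero)
  show "symp ?R"
    unfolding symp_def tensor_rel_def using cvec.span_neg by (metis (no_types) minus_diff_eq)
  show "transp ?R"
  proof (rule transpI)
    fix p q r :: "'a \<times> 'b \<Rightarrow>\<^sub>0 complex"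
    assume "tensor_rel p q" "tensor_rel q r"
    then have "(p - q) + (q - r) \<in> cvec.span tensor_relators"
      unfolding tensor_rel_def by (rule cvec.span_add)
    then show "tensor_rel p r"
      by (simp add: tensor_rel_def)
  qed
qed

quotient_type (overloaded) ('a, 'b) tensor (infixr \<open>\<otimes>\<close> 75) =
  "('a::complex_vector \<times> 'b::complex_vector) \<Rightarrow>\<^sub>0 complex" / tensor_rel
  by (rule equivp_tensor_rel)

instantiation tensor :: (complex_vector, complex_vector) complex_vector
begin

lift_definition zero_tensor :: "'a \<otimes> 'b" is 0 .

lift_definition plus_tensor :: "'a \<otimes> 'b \<Rightarrow> 'a \<otimes> 'b \<Rightarrow> 'a \<otimes> 'b" is "(+)"
  unfolding tensor_rel_def by (simp only: add_diff_add cvec.span_add)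

lift_definition uminus_tensor :: "'a \<otimes> 'b \<Rightarrow> 'a \<otimes> 'b" is "uminus"
  unfolding tensor_rel_def by (simp only: minus_diff_minus cvec.span_neg)

lift_definition minus_tensor :: "'a \<otimes> 'b \<Rightarrow> 'a \<otimes> 'b \<Rightarrow> 'a \<otimes> 'b" is "(-)"
proof -
  fix p p' q q' :: "'a \<times> 'b \<Rightarrow>\<^sub>0 complex"
  assume "tensor_rel p p'" "tensor_rel q q'"
  then have "(p - p') - (q - q') \<in> cvec.span tensor_relators"
    unfolding tensor_rel_def by (rule cvec.span_diff)
  then show "tensor_rel (p - q) (p' - q')"
    by (simp add: tensor_rel_def algebra_simps)
qed

lift_definition scaleC_tensor :: "complex \<Rightarrow> 'a \<otimes> 'b \<Rightarrow> 'a \<otimes> 'b" is "scaleC"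
  unfolding tensor_rel_def by (simp only: cvec.scale_right_diff_distrib[symmetric] cvec.span_scale)

instance
  by standard (transfer; simp add: tensor_rel_def cvec.span_zero algebra_simps)+

end

lift_definition tensor_pure :: "'a::complex_vector \<Rightarrow> 'b::complex_vector \<Rightarrow> 'a \<otimes> 'b" (infixr \<open>\<otimes>\<close> 75)
  is "\<lambda>a b. Poly_Mapping.single (a, b) 1" .

text \<open>\<open>tensor_lift B\<close> is the linear map on the tensor product induced by a bilinear map \<open>B\<close>
  (see \<open>tensor_lift_pure\<close>, \<open>clinear_tensor_lift\<close> and \<open>tensor_lift_unique\<close> below); for \<open>B\<close> that
  is not bilinear its value depends on the chosen representative. In Sweedler notation,
  \<open>tensor_lift B (\<Delta> x)\<close> is \<open>B x\<^sub>(\<^sub>1\<^sub>) x\<^sub>(\<^sub>2\<^sub>)\<close>.\<close>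

definition free_lift ::
  "('a::complex_vector \<Rightarrow> 'b::complex_vector \<Rightarrow> 'c::complex_vector) \<Rightarrow> ('a \<times> 'b \<Rightarrow>\<^sub>0 complex) \<Rightarrow> 'c" where
  "free_lift B p = (\<Sum>k\<in>Poly_Mapping.keys p. Poly_Mapping.lookup p k *\<^sub>C B (fst k) (snd k))"

definition tensor_lift ::
  "('a::complex_vector \<Rightarrow> 'b::complex_vector \<Rightarrow> 'c::complex_vector) \<Rightarrow> 'a \<otimes> 'b \<Rightarrow> 'c" where
  "tensor_lift B t = free_lift B (rep_tensor t)"

lemma free_lift_superset:
  assumes "finite A" "Poly_Mapping.keys p \<subseteq> A"
  shows "free_lift B p = (\<Sum>k\<in>A. Poly_Mapping.lookup p k *\<^sub>C B (fst k) (snd k))"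
  unfolding free_lift_def using assms
  by (intro sum.mono_neutral_left) (auto simp: in_keys_iff)

lemma free_lift_add: "free_lift B (p + q) = free_lift B p + free_lift B q"
proof -
  let ?A = "Poly_Mapping.keys p \<union> Poly_Mapping.keys q"
  have "Poly_Mapping.keys (p + q) \<subseteq> ?A" by (rule keys_add)
  then show ?thesis
    by (simp add: free_lift_superset[of ?A] lookup_add cvec.scale_left_distrib sum.distrib)
qed

lemma free_lift_scale: "free_lift B (c *\<^sub>C p) = c *\<^sub>C free_lift B p"
proof -
  have "Poly_Mapping.keys (c *\<^sub>C p) \<subseteq> Poly_Mapping.keys p"
    by (auto simp: in_keys_iff scaleC_poly_mapping.rep_eq)
  then show ?thesis
    by (simp add: free_lift_superset[of "Poly_Mapping.keys p"] scaleC_poly_mapping.rep_eq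
        scaleC_complex_def cvec.scale_sum_right)
qed

lemma free_lift_single: "free_lift B (Poly_Mapping.single (a, b) c) = c *\<^sub>C B a b"
  by (simp add: free_lift_superset[of "{(a, b)}"])

lemma clinear_free_lift: "clinear (free_lift B)"
  by (simp add: clinear_iff free_lift_add free_lift_scale)

lemma free_lift_diff: "free_lift B (p - q) = free_lift B p - free_lift B q"
  by (metis add_diff_cancel diff_add_cancel free_lift_add)

lemma free_lift_relators:
  assumes "cbilinear B" "p \<in> cvec.span tensor_relators"
  shows "free_lift B p = 0"
  using assms(2)
proof (induction rule: cvec.span_induct_alt)
  case base
  show ?case by (simp add: free_lift_def)
next
  case (step c x y)
  have "free_lift B x = 0"
    using step.hyps(1) assms(1)
    by (auto simp: tensor_relators_def free_lift_diff free_lift_scale free_lift_single cbilinear_iff)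
  then show ?case
    using step by (simp add: free_lift_add free_lift_scale)
qed

lemma tensor_lift_abs:
  assumes "cbilinear B"
  shows "tensor_lift B (abs_tensor p) = free_lift B p"
proof -
  have "tensor_rel (rep_tensor (abs_tensor p)) p"
    by (rule Quotient3_rep_abs[OF Quotient3_tensor]) (simp add: tensor_rel_def cvec.span_zero)
  then have "free_lift B (rep_tensor (abs_tensor p) - p) = 0"
    using free_lift_relators[OF assms] by (simp add: tensor_rel_def)
  then show ?thesis
    by (simp add: tensor_lift_def free_lift_diff)
qed

lemma tensor_lift_pure:
  assumes "cbilinear B"
  shows "tensor_lift B (a \<otimes> b) = B a b"
  by (simp add: tensor_pure.abs_eq tensor_lift_abs[OF assms] free_lift_single)

lemma clinear_tensor_lift:
  assumes "cbilinear B"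
  shows "clinear (tensor_lift B)"
proof -
  have "tensor_lift B (s + t) = tensor_lift B s + tensor_lift B t" for s t
    by (induction s; induction t)
      (simp add: plus_tensor.abs_eq tensor_lift_abs[OF assms] free_lift_add)
  moreover have "tensor_lift B (c *\<^sub>C t) = c *\<^sub>C tensor_lift B t" for c t
    by (induction t) (simp add: scaleC_tensor.abs_eq tensor_lift_abs[OF assms] free_lift_scale)
  ultimately show ?thesis by (simp add: clinear_iff)
qed

lemma cbilinear_tensor_pure: "cbilinear (\<otimes>)"
  unfolding cbilinear_iff
  by (intro conjI allI; transfer; unfold tensor_rel_def diff_diff_add[symmetric];
      rule cvec.span_base; unfold tensor_relators_def; blast)

lemma tensor_pure_add_left: "(a + a') \<otimes> b = a \<otimes> b + a' \<otimes> b"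
  and tensor_pure_add_right: "a \<otimes> (b + b') = a \<otimes> b + a \<otimes> b'"
  and tensor_pure_scale_left: "(c *\<^sub>C a) \<otimes> b = c *\<^sub>C (a \<otimes> b)"
  and tensor_pure_scale_right: "a \<otimes> (c *\<^sub>C b) = c *\<^sub>C (a \<otimes> b)"
  using cbilinear_tensor_pure unfolding cbilinear_iff by blast+

lemmas tensor_pure_simps =
  tensor_pure_add_left tensor_pure_add_right tensor_pure_scale_left tensor_pure_scale_right

lemma tensor_induct [case_names zero pure add]:
  fixes t :: "'a::complex_vector \<otimes> 'b::complex_vector"
  assumes "P 0" and pure: "\<And>a b. P (a \<otimes> b)" and "\<And>s t. P s \<Longrightarrow> P t \<Longrightarrow> P (s + t)"
  shows "P t"
proof -
  have "P (abs_tensor p)" for p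
  proof (induction p rule: update_induct)
    case const
    show ?case using assms(1) by (simp add: zero_tensor.abs_eq)
  next
    case (update f k c)
    obtain a b where k: "k = (a, b)" by (cases k)
    have "Poly_Mapping.update k c f = f + c *\<^sub>C Poly_Mapping.single k 1"
      using update
      by (intro poly_mapping_eqI)
        (auto simp: lookup_update lookup_add lookup_single scaleC_poly_mapping.rep_eq
          scaleC_complex_def in_keys_iff when_def)
    then have "abs_tensor (Poly_Mapping.update k c f) = abs_tensor f + c *\<^sub>C (a \<otimes> b)"
      by (simp add: k plus_tensor.abs_eq scaleC_tensor.abs_eq tensor_pure.abs_eq)
    also have "c *\<^sub>C (a \<otimes> b) = (c *\<^sub>C a) \<otimes> b"
      by (simp add: tensor_pure_scale_left)
    finally show ?case
      using assms(3) pure update by simp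
  qed
  then show ?thesis by (induction t)
qed

lemma tensor_lift_unique:
  assumes "clinear F" "clinear G" "\<And>a b. F (a \<otimes> b) = G (a \<otimes> b)"
  shows "F = G"
proof
  fix t
  have "F 0 = 0" "G 0 = 0"
    using assms(1,2) by (metis clinear_iff cvec.scale_zero_left)+
  then show "F t = G t"
    using assms by (induction t rule: tensor_induct) (simp_all add: clinear_iff)
qed

subsection \<open>The tensor product of two algebras\<close>

instantiation tensor :: (complex_algebra_1, complex_algebra_1) complex_algebra_1
begin

definition one_tensor :: "'a \<otimes> 'b" where
  "one_tensor = 1 \<otimes> 1"

definition times_tensor :: "'a \<otimes> 'b \<Rightarrow> 'a \<otimes> 'b \<Rightarrow> 'a \<otimes> 'b" where
  "times_tensor s t = tensor_lift (\<lambda>a b. tensor_lift (\<lambda>c d. (a * c) \<otimes> (b * d)) t) s"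

instance
proof -
  have bi: "cbilinear (\<lambda>c d. (a * c) \<otimes> (b * d))" for a :: 'a and b :: 'b
    by (simp add: cbilinear_iff distrib_left mult_scaleC_right tensor_pure_simps)
  have lift_add: "tensor_lift (\<lambda>c d. (a * c) \<otimes> (b * d)) (s + t) =
      tensor_lift (\<lambda>c d. (a * c) \<otimes> (b * d)) s + tensor_lift (\<lambda>c d. (a * c) \<otimes> (b * d)) t"
    and lift_scale: "tensor_lift (\<lambda>c d. (a * c) \<otimes> (b * d)) (k *\<^sub>C t) =
      k *\<^sub>C tensor_lift (\<lambda>c d. (a * c) \<otimes> (b * d)) t"
    for a :: 'a and b :: 'b and s t k
    using clinear_tensor_lift[OF bi] unfolding clinear_iff by blast+
  have lift_zero: "tensor_lift (\<lambda>c d. (a * c) \<otimes> (b * d)) 0 = 0" for a :: 'a and b :: 'b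
    using lift_scale[of a b 0 0] by simp
  have bi2: "cbilinear (\<lambda>a b. tensor_lift (\<lambda>c d. (a * c) \<otimes> (b * d)) t)" for t :: "'a \<otimes> 'b"
  proof (induction t rule: tensor_induct)
    case zero
    show ?case by (simp add: lift_zero cbilinear_iff)
  next
    case (pure c d)
    show ?case
      by (simp add: tensor_lift_pure[OF bi] cbilinear_iff distrib_right mult_scaleC_left tensor_pure_simps)
  next
    case (add s t)
    then show ?case
      by (simp add: lift_add cbilinear_iff cvec.scale_right_distrib add_ac)
  qed
  have pure: "(a \<otimes> b) * (c \<otimes> d) = (a * c) \<otimes> (b * d)" for a c :: 'a and b d :: 'b
    unfolding times_tensor_def tensor_lift_pure[OF bi2] by (rule tensor_lift_pure[OF bi])
  have addl: "(s + s') * t = s * t + s' * t" and scalel: "(k *\<^sub>C s) * t = k *\<^sub>C (s * t)"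
    for s s' t :: "'a \<otimes> 'b" and k
    using clinear_tensor_lift[OF bi2] unfolding clinear_iff times_tensor_def by blast+
  have zerol: "0 * t = 0" for t :: "'a \<otimes> 'b"
    using scalel[of 0 0 t] by simp
  have addr: "s * (t + t') = s * t + s * t'" for s t t' :: "'a \<otimes> 'b"
  proof (induction s rule: tensor_induct)
    case (pure a b)
    show ?case unfolding times_tensor_def tensor_lift_pure[OF bi2] by (rule lift_add)
  qed (simp_all add: zerol addl add_ac)
  have scaler: "s * (k *\<^sub>C t) = k *\<^sub>C (s * t)" for s t :: "'a \<otimes> 'b" and k
  proof (induction s rule: tensor_induct)
    case (pure a b)
    show ?case unfolding times_tensor_def tensor_lift_pure[OF bi2] by (rule lift_scale)
  qed (simp_all add: zerol addl cvec.scale_right_distrib)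
  have zeror: "t * 0 = 0" for t :: "'a \<otimes> 'b"
    using scaler[of t 0 0] by simp
  have assoc1: "((a \<otimes> b) * (c \<otimes> d)) * u = (a \<otimes> b) * ((c \<otimes> d) * u)"
    for a c :: 'a and b d :: 'b and u
    by (induction u rule: tensor_induct) (simp_all add: zeror addr pure mult.assoc)
  have assoc2: "((a \<otimes> b) * t) * u = (a \<otimes> b) * (t * u)" for a :: 'a and b :: 'b and t u
    by (induction t rule: tensor_induct) (simp_all add: zerol zeror addl addr assoc1)
  have assoc: "(s * t) * u = s * (t * u)" for s t u :: "'a \<otimes> 'b"
    by (induction s rule: tensor_induct) (simp_all add: zerol addl assoc2)
  have onel: "1 * t = t" for t :: "'a \<otimes> 'b"
    unfolding one_tensor_def by (induction t rule: tensor_induct) (simp_all add: zeror addr pure)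
  have oner: "t * 1 = t" for t :: "'a \<otimes> 'b"
    unfolding one_tensor_def by (induction t rule: tensor_induct) (simp_all add: zerol addl pure)
  show "OFCLASS('a \<otimes> 'b, complex_algebra_1_class)"
    by standard (fact assoc onel oner addl addr scalel scaler)+
qed

end


section \<open>Bialgebras and modules\<close>

definition tensor_map :: "('a::complex_vector \<Rightarrow> 'c::complex_vector) \<Rightarrow> ('b::complex_vector \<Rightarrow> 'd::complex_vector)
    \<Rightarrow> 'a \<otimes> 'b \<Rightarrow> 'c \<otimes> 'd" where
  "tensor_map f g = tensor_lift (\<lambda>a b. f a \<otimes> g b)"

definition tensor_assoc ::
  "('a::complex_vector \<otimes> 'b::complex_vector) \<otimes> 'c::complex_vector \<Rightarrow> 'a \<otimes> 'b \<otimes> 'c" where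
  "tensor_assoc = tensor_lift (\<lambda>s c. tensor_lift (\<lambda>a b. a \<otimes> b \<otimes> c) s)"

lemma tensor_map_pure:
  assumes "clinear f" "clinear g"
  shows "tensor_map f g (a \<otimes> b) = f a \<otimes> g b"
  unfolding tensor_map_def using assms
  by (intro tensor_lift_pure) (simp add: cbilinear_iff clinear_iff tensor_pure_simps)

lemma tensor_assoc_pure:
  fixes a :: "'a::complex_vector" and b :: "'b::complex_vector" and c :: "'c::complex_vector"
  shows "tensor_assoc ((a \<otimes> b) \<otimes> c) = a \<otimes> b \<otimes> c"
proof -
  have 1: "cbilinear (\<lambda>a b. a \<otimes> b \<otimes> c)" for c :: 'c
    by (simp add: cbilinear_iff tensor_pure_simps)
  have add: "tensor_lift (\<lambda>a b. a \<otimes> b \<otimes> c) (s + t) =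
      tensor_lift (\<lambda>a b. a \<otimes> b \<otimes> c) s + tensor_lift (\<lambda>a b. a \<otimes> b \<otimes> c) t"
    and scale: "tensor_lift (\<lambda>a b. a \<otimes> b \<otimes> c) (k *\<^sub>C s) =
      k *\<^sub>C tensor_lift (\<lambda>a b. a \<otimes> b \<otimes> c) s" for c :: 'c and s t :: "'a \<otimes> 'b" and k
    using clinear_tensor_lift[OF 1] unfolding clinear_iff by blast+
  have zero: "tensor_lift (\<lambda>a b. a \<otimes> b \<otimes> c) (0 :: 'a \<otimes> 'b) = 0" for c :: 'c
    using scale[of c 0 0] by simp
  have "tensor_lift (\<lambda>a b. a \<otimes> b \<otimes> (c + c')) s =
        tensor_lift (\<lambda>a b. a \<otimes> b \<otimes> c) s + tensor_lift (\<lambda>a b. a \<otimes> b \<otimes> c') s"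
    for c c' :: 'c and s :: "'a \<otimes> 'b"
  proof (induction s rule: tensor_induct)
    case (pure a b)
    show ?case unfolding tensor_lift_pure[OF 1] by (simp add: tensor_pure_simps)
  qed (simp_all only: zero add add_ac add_0)
  moreover have "tensor_lift (\<lambda>a b. a \<otimes> b \<otimes> (k *\<^sub>C c)) s =
        k *\<^sub>C tensor_lift (\<lambda>a b. a \<otimes> b \<otimes> c) s" for k and c :: 'c and s :: "'a \<otimes> 'b"
  proof (induction s rule: tensor_induct)
    case (pure a b)
    show ?case unfolding tensor_lift_pure[OF 1] by (simp add: tensor_pure_simps)
  qed (simp_all only: zero add cvec.scale_right_distrib cvec.scale_zero_right)
  ultimately have "cbilinear (\<lambda>(s :: 'a \<otimes> 'b) (c :: 'c). tensor_lift (\<lambda>a b. a \<otimes> b \<otimes> c) s)"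
    unfolding cbilinear_iff by (simp only: add scale simp_thms)
  from tensor_lift_pure[OF this] show ?thesis
    unfolding tensor_assoc_def by (simp only: tensor_lift_pure[OF 1])
qed

locale bialgebra =
  fixes \<Delta> :: "'u::complex_algebra_1 \<Rightarrow> 'u \<otimes> 'u"
    and \<epsilon> :: "'u \<Rightarrow> complex"
  assumes linear_comult: "clinear \<Delta>"
    and linear_counit: "clinear \<epsilon>"
    and coassoc: "tensor_assoc (tensor_map \<Delta> id (\<Delta> x)) = tensor_map id \<Delta> (\<Delta> x)"
    and counit_left: "tensor_lift (\<lambda>a b. \<epsilon> a *\<^sub>C b) (\<Delta> x) = x"
    and counit_right: "tensor_lift (\<lambda>a b. \<epsilon> b *\<^sub>C a) (\<Delta> x) = x"
    and comult_one: "\<Delta> 1 = 1"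
    and comult_mult: "\<Delta> (x * y) = \<Delta> x * \<Delta> y"
    and counit_one: "\<epsilon> 1 = 1"
    and counit_mult: "\<epsilon> (x * y) = \<epsilon> x * \<epsilon> y"

locale left_module =
  fixes act :: "'u::complex_algebra_1 \<Rightarrow> 'c::complex_vector \<Rightarrow> 'c"
  assumes bilinear_act: "cbilinear act"
    and act_one: "act 1 f = f"
    and act_mult: "act (x * y) f = act x (act y f)"

end

theory Submission
  imports Defs
begin

text \<open>
  In Sweedler notation \<open>\<Delta> x = x\<^sub>1 \<otimes> x\<^sub>2\<close>, the formula \<open>x \<cdot> f = \<xi> x\<^sub>1 f * \<phi> x\<^sub>2\<close> is the product rule
  \<open>x \<cdot> (f * g) = \<xi> x\<^sub>1 f * (x\<^sub>2 \<cdot> g)\<close> at \<open>g = 1\<close>. So an action with the product rule is determined by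
  its values \<open>\<phi> x = x \<cdot> 1\<close> on the unit, and the two conditions on \<open>\<phi>\<close> say that \<open>1 \<cdot> 1 = 1\<close> and
  \<open>(x * y) \<cdot> 1 = x \<cdot> (y \<cdot> 1)\<close>. This is the converse part.

  In the direct part, \<open>\<phi> x = x \<cdot> 1\<close> is the counit law, since \<open>\<xi> x\<^sub>1 1 = \<epsilon> x\<^sub>1\<close>. The product rule comes
  before associativity: once \<open>\<xi>\<close> is distributed over \<open>f * g\<close>, its two sides are the same trilinear
  expression in the threefold coproduct of \<open>x\<close>, bracketed in two ways, and \<open>Sweedler_coassoc\<close>
  identifies them. The condition on \<open>\<phi>\<close> now reads \<open>\<phi> (x * y) = x \<cdot> \<phi> y\<close>, and therefore
  \<open>x \<cdot> (y \<cdot> f) = x \<cdot> (\<xi> y\<^sub>1 f * \<phi> y\<^sub>2) = \<xi> x\<^sub>1 (\<xi> y\<^sub>1 f) * (x\<^sub>2 \<cdot> \<phi> y\<^sub>2) = \<xi> (x\<^sub>1 * y\<^sub>1) f * \<phi> (x\<^sub>2 * y\<^sub>2)\<close>.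
  The last term is \<open>(x * y) \<cdot> f\<close>, because the comultiplication is multiplicative
  (\<open>tensor_lift_mult\<close>).
\<close>

text \<open>\<^term>\<open>tensor_lift B t\<close> is a finite sum over a representative of \<open>t\<close> that is chosen
  independently of \<open>B\<close>. Sums of Sweedler type can therefore be added, mapped and interchanged
  for arbitrary \<open>B\<close>; bilinearity matters only when the tensor \<open>t\<close> itself is varied or computed.\<close>

lemma tensor_lift_add_fun:
  "tensor_lift (\<lambda>a b. B a b + B' a b) t = tensor_lift B t + tensor_lift B' t"
  by (simp add: tensor_lift_def free_lift_def cvec.scale_right_distrib sum.distrib)

lemma clinear_image_tensor_lift:
  assumes "clinear F"
  shows "F (tensor_lift B t) = tensor_lift (\<lambda>a b. F (B a b)) t"
proof -
  interpret F: Vector_Spaces.linear scaleC scaleC F by (fact assms)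
  show ?thesis by (simp add: tensor_lift_def free_lift_def F.sum F.scale)
qed

lemma clinear_scaleC: "clinear (\<lambda>x. c *\<^sub>C x)"
  by (simp add: clinear_iff cvec.scale_right_distrib mult.commute)

lemma clinear_compose: "clinear F \<Longrightarrow> clinear G \<Longrightarrow> clinear (\<lambda>x. F (G x))"
  by (simp add: clinear_iff)

lemma clinear_tensor_lift_param:
  assumes "\<And>a b. clinear (\<lambda>p. B p a b)"
  shows "clinear (\<lambda>p. tensor_lift (B p) t)"
proof -
  have "B (p + q) = (\<lambda>a b. B p a b + B q a b)" "B (c *\<^sub>C p) = (\<lambda>a b. c *\<^sub>C B p a b)" for p q c
    using assms by (auto simp: clinear_iff intro!: ext)
  then show ?thesis
    by (simp add: clinear_iff tensor_lift_add_fun clinear_image_tensor_lift[OF clinear_scaleC])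
qed

lemma tensor_lift_swap:
  "tensor_lift (\<lambda>a b. tensor_lift (\<lambda>c d. G a b c d) t) s =
   tensor_lift (\<lambda>c d. tensor_lift (\<lambda>a b. G a b c d) s) t"
  unfolding tensor_lift_def free_lift_def
  by (simp add: cvec.scale_sum_right mult.commute)
    (rule sum.swap)

lemma tensor_lift_mult:
  assumes "cbilinear B"
  shows "tensor_lift B (s * t) = tensor_lift (\<lambda>a b. tensor_lift (\<lambda>c d. B (a * c) (b * d)) t) s"
  unfolding times_tensor_def
  by (simp add: clinear_image_tensor_lift[OF clinear_tensor_lift[OF assms]] tensor_lift_pure[OF assms])

lemma cbilinear_tensor_assoc:
  "cbilinear (\<lambda>s c. tensor_lift (\<lambda>a b. a \<otimes> b \<otimes> c) s)"
  unfolding cbilinear_def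
  by (intro conjI allI clinear_tensor_lift_param clinear_tensor_lift)
    (simp_all add: clinear_iff cbilinear_iff tensor_pure_simps)

lemma tensor_assoc_pure_right:
  "tensor_assoc (s \<otimes> c) = tensor_lift (\<lambda>a b. a \<otimes> b \<otimes> c) s"
  unfolding tensor_assoc_def by (rule tensor_lift_pure[OF cbilinear_tensor_assoc])

text \<open>The coassociativity axiom is an identity of tensors. A trilinear \<open>T\<close> induces a linear map on
  the threefold tensor product, and applying that map to both sides gives the identity
  \<open>T x\<^sub>1\<^sub>1 x\<^sub>1\<^sub>2 x\<^sub>2 = T x\<^sub>1 x\<^sub>2\<^sub>1 x\<^sub>2\<^sub>2\<close> in the form in which calculations use it.\<close>

lemma (in bialgebra) Sweedler_coassoc:
  assumes bilinear: "\<And>a. cbilinear (T a)"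
    and linear: "\<And>b c. clinear (\<lambda>a. T a b c)"
  shows "tensor_lift (\<lambda>a b. tensor_lift (\<lambda>c d. T c d b) (\<Delta> a)) (\<Delta> x) =
         tensor_lift (\<lambda>a b. tensor_lift (\<lambda>c d. T a c d) (\<Delta> b)) (\<Delta> x)"
proof -
  \<comment> \<open>The linear map induced by \<open>T\<close>.\<close>
  define G where "G = tensor_lift (\<lambda>a. tensor_lift (T a))"
  have bi: "cbilinear (\<lambda>a. tensor_lift (T a))"
    unfolding cbilinear_def
    by (intro conjI allI clinear_tensor_lift clinear_tensor_lift_param bilinear linear)
  have G: "clinear G" "G (a \<otimes> t) = tensor_lift (T a) t" for a t
    unfolding G_def by (rule clinear_tensor_lift[OF bi], rule tensor_lift_pure[OF bi])
  have assoc: "clinear (tensor_assoc :: ('u \<otimes> 'u) \<otimes> 'u \<Rightarrow> _)"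
    unfolding tensor_assoc_def
    by (rule clinear_tensor_lift[OF cbilinear_tensor_assoc])
  have "G (tensor_assoc (tensor_map \<Delta> id (\<Delta> x))) =
      tensor_lift (\<lambda>a b. tensor_lift (\<lambda>c d. T c d b) (\<Delta> a)) (\<Delta> x)"
    by (simp add: tensor_map_def clinear_image_tensor_lift[OF assoc] clinear_image_tensor_lift[OF G(1)]
        tensor_assoc_pure_right G(2) tensor_lift_pure[OF bilinear])
  moreover have "G (tensor_map id \<Delta> (\<Delta> x)) =
      tensor_lift (\<lambda>a b. tensor_lift (\<lambda>c d. T a c d) (\<Delta> b)) (\<Delta> x)"
    by (simp add: tensor_map_def clinear_image_tensor_lift[OF G(1)] G(2))
  ultimately show ?thesis
    by (simp add: coassoc)
qed

theorem proposition1: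
  fixes \<Delta> :: "'u::complex_algebra_1 \<Rightarrow> 'u \<otimes> 'u"
    and \<epsilon> :: "'u \<Rightarrow> complex"
    and \<xi> :: "'u \<Rightarrow> 'c::complex_algebra_1 \<Rightarrow> 'c"
  assumes "bialgebra \<Delta> \<epsilon>"
    and "left_module \<xi>"
    and "\<And>x. \<xi> x 1 = \<epsilon> x *\<^sub>C 1"
    and "\<And>x f g. \<xi> x (f * g) = tensor_lift (\<lambda>a b. \<xi> a f * \<xi> b g) (\<Delta> x)"
  shows "(\<forall>\<phi> act.
            clinear \<phi> \<and> \<phi> 1 = 1 \<and>
            (\<forall>x y. \<phi> (x * y) = tensor_lift (\<lambda>a b. \<xi> a (\<phi> y) * \<phi> b) (\<Delta> x)) \<and>
            (\<forall>x f. act x f = tensor_lift (\<lambda>a b. \<xi> a f * \<phi> b) (\<Delta> x))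
          \<longrightarrow> left_module act \<and>
              (\<forall>x f g. act x (f * g) = tensor_lift (\<lambda>a b. \<xi> a f * act b g) (\<Delta> x)) \<and>
              (\<forall>x. \<phi> x = act x 1))
       \<and> (\<forall>act \<phi>.
            left_module act \<and>
            (\<forall>x f g. act x (f * g) = tensor_lift (\<lambda>a b. \<xi> a f * act b g) (\<Delta> x)) \<and>
            (\<forall>x. \<phi> x = act x 1)
          \<longrightarrow> clinear \<phi> \<and> \<phi> 1 = 1 \<and>
              (\<forall>x y. \<phi> (x * y) = tensor_lift (\<lambda>a b. \<xi> a (\<phi> y) * \<phi> b) (\<Delta> x)) \<and>
              (\<forall>x f. act x f = tensor_lift (\<lambda>a b. \<xi> a f * \<phi> b) (\<Delta> x)))"
proof (rule conjI; intro allI impI; elim conjE)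
  interpret bialgebra \<Delta> \<epsilon> by (fact assms(1))
  interpret \<xi>: left_module \<xi> by (fact assms(2))
  have lin_mult_left: "clinear (\<lambda>f. f * g)" and lin_mult_right: "clinear (\<lambda>g. f * g)" for f g :: 'c
    by (simp_all add: clinear_iff distrib_left distrib_right mult_scaleC_left mult_scaleC_right)
  have \<xi>_lin: "clinear (\<xi> x)" "clinear (\<lambda>x. \<xi> x f)" for x f
    using \<xi>.bilinear_act by (simp_all add: cbilinear_def)
  fix \<phi> act
  assume \<phi>: "clinear \<phi>" "\<phi> 1 = 1"
    and \<phi>_mult: "\<forall>x y. \<phi> (x * y) = tensor_lift (\<lambda>a b. \<xi> a (\<phi> y) * \<phi> b) (\<Delta> x)"
    and act: "\<forall>x f. act x f = tensor_lift (\<lambda>a b. \<xi> a f * \<phi> b) (\<Delta> x)"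
  have bi: "cbilinear (\<lambda>a b. \<xi> a f * \<phi> b)" for f
    unfolding cbilinear_def
    by (intro conjI allI clinear_compose[OF lin_mult_left \<xi>_lin(2)]
        clinear_compose[OF lin_mult_right \<phi>(1)])
  have act_lin: "clinear (act x)" "clinear (\<lambda>x. act x f)" for x f
  proof -
    show "clinear (act x)"
      unfolding act[rule_format, abs_def]
      by (intro clinear_tensor_lift_param clinear_compose[OF lin_mult_left \<xi>_lin(1)])
    show "clinear (\<lambda>x. act x f)"
      unfolding act[rule_format, abs_def]
      by (rule clinear_compose[OF clinear_tensor_lift[OF bi] linear_comult])
  qed
  have product: "act x (f * g) = tensor_lift (\<lambda>a b. \<xi> a f * act b g) (\<Delta> x)" for x f g
  proof -
    have "act x (f * g) =
        tensor_lift (\<lambda>a b. tensor_lift (\<lambda>c d. \<xi> c f * \<xi> d g * \<phi> b) (\<Delta> a)) (\<Delta> x)"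
      by (simp add: act assms(4) clinear_image_tensor_lift[OF lin_mult_left])
    also have "\<dots> = tensor_lift (\<lambda>a b. tensor_lift (\<lambda>c d. \<xi> a f * \<xi> c g * \<phi> d) (\<Delta> b)) (\<Delta> x)"
    proof (rule Sweedler_coassoc)
      show "cbilinear (\<lambda>c d. \<xi> a f * \<xi> c g * \<phi> d)" for a
        using bi[of g] by (simp add: cbilinear_iff mult.assoc distrib_left mult_scaleC_right)
      show "clinear (\<lambda>a. \<xi> a f * \<xi> b g * \<phi> c)" for b c
        using clinear_compose[OF lin_mult_left \<xi>_lin(2)] by (simp add: mult.assoc)
    qed
    also have "\<dots> = tensor_lift (\<lambda>a b. \<xi> a f * act b g) (\<Delta> x)"
      by (simp add: act clinear_image_tensor_lift[OF lin_mult_right] mult.assoc)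
    finally show ?thesis .
  qed
  \<comment> \<open>Expand the inner action first: the outer one then meets products and can use the product rule.\<close>
  have act_act: "act (x * y) f = act x (act y f)" for x y f
  proof -
    have act_\<phi>: "act b (\<phi> d) = \<phi> (b * d)" for b d
      by (simp add: act \<phi>_mult)
    have "act x (act y f) = tensor_lift (\<lambda>c d. act x (\<xi> c f * \<phi> d)) (\<Delta> y)"
      by (subst (2) act[rule_format]) (rule clinear_image_tensor_lift[OF act_lin(1)])
    also have "\<dots> = tensor_lift (\<lambda>c d. tensor_lift (\<lambda>a b. \<xi> (a * c) f * \<phi> (b * d)) (\<Delta> x)) (\<Delta> y)"
      by (simp add: product act_\<phi> \<xi>.act_mult)
    also have "\<dots> = tensor_lift (\<lambda>a b. tensor_lift (\<lambda>c d. \<xi> (a * c) f * \<phi> (b * d)) (\<Delta> y)) (\<Delta> x)"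
      by (rule tensor_lift_swap)
    also have "\<dots> = act (x * y) f"
      by (simp add: act comult_mult tensor_lift_mult[OF bi])
    finally show ?thesis by simp
  qed
  have "act 1 f = f" for f
    by (simp add: act comult_one one_tensor_def tensor_lift_pure[OF bi] \<xi>.act_one \<phi>(2))
  with act_lin act_act have "left_module act"
    by (simp add: left_module_def cbilinear_def)
  moreover have "\<phi> x = act x 1" for x
  proof -
    have "\<phi> x = \<phi> (tensor_lift (\<lambda>a b. \<epsilon> a *\<^sub>C b) (\<Delta> x))"
      by (simp add: counit_left)
    also have "\<dots> = act x 1"
      using \<phi>(1) unfolding clinear_image_tensor_lift[OF \<phi>(1)]
      by (simp add: act assms(3) clinear_iff mult_scaleC_left)
    finally show ?thesis .
  qed
  ultimately show "left_module act \<and>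
      (\<forall>x f g. act x (f * g) = tensor_lift (\<lambda>a b. \<xi> a f * act b g) (\<Delta> x)) \<and>
      (\<forall>x. \<phi> x = act x 1)"
    using product by blast
next
  fix act \<phi>
  assume "left_module act"
    and product: "\<forall>x f g. act x (f * g) = tensor_lift (\<lambda>a b. \<xi> a f * act b g) (\<Delta> x)"
    and \<phi>: "\<forall>x. \<phi> x = act x 1"
  interpret act: left_module act by (fact \<open>left_module act\<close>)
  have \<phi>_eq: "\<phi> = (\<lambda>x. act x 1)"
    using \<phi> by auto
  have "clinear \<phi>"
    using act.bilinear_act by (simp add: \<phi>_eq cbilinear_def)
  moreover have "\<phi> 1 = 1"
    by (simp add: \<phi> act.act_one)
  moreover have act: "act x f = tensor_lift (\<lambda>a b. \<xi> a f * \<phi> b) (\<Delta> x)" for x f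
    using product[rule_format, of x f 1] by (simp add: \<phi>)
  moreover have "\<phi> (x * y) = tensor_lift (\<lambda>a b. \<xi> a (\<phi> y) * \<phi> b) (\<Delta> x)" for x y
    using act[of x "\<phi> y"] by (simp add: \<phi> act.act_mult)
  ultimately show "clinear \<phi> \<and> \<phi> 1 = 1 \<and>
      (\<forall>x y. \<phi> (x * y) = tensor_lift (\<lambda>a b. \<xi> a (\<phi> y) * \<phi> b) (\<Delta> x)) \<and>
      (\<forall>x f. act x f = tensor_lift (\<lambda>a b. \<xi> a f * \<phi> b) (\<Delta> x))"
    by blast
qed

end
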